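(* Let $\eta>0$. The family of priors (for each number of teams $t\ge2$) under which the log-strengths $\lambda_1,\dots,\lambda_t$ are independent and identically distributed with the Type III generalized logistic density $$f_{\Lambda_i}(\lambda_i|I_{\mathrm B})\propto(1+e^{-\lambda_i})^{-\eta}(1+e^{\lambda_i})^{-\eta}$$ (equivalently, the quantities $\zeta_i=\pi_i/(1+\pi_i)=(1+e^{-\lambda_i})^{-1}$ are independent with Beta density proportional to $\zeta_i^{\eta-1}(1-\zeta_i)^{\eta-1}$) satisfies all four desiderata: invariance under interchange of teams, invariance under interchange of winning and losing, normalizability, and invariance under elimination of teams.
   Context: Bradley-Terry model: $t$ teams have strengths $\pi_1,\dots,\pi_t\in(0,\infty)$ and log-strengths $\lambda_i=\ln\pi_i$; $\gamma_{ij}=\lambda_i-\lambda_j$. Let $\gamma=(\gamma_{1t},\dots,\gamma_{(t-1)t})\in\mathbb R^{t-1}$ (any other linear basis of the differences may be used). A prior on the log-strengths (equivalently, on the strengths) induces a density $f_\Gamma(\gamma|I)$ of $\gamma$. Two priors are equivalent ($\cong$) if their induced densities $f_\Gamma$ are equal (almost everywhere). Desiderata: 1. Invariance under interchange of teams: for any $i\ne j$, the transformation exchanging $\lambda_i$ and $\lambda_j$ and fixing all other $\lambda_k$ transforms the prior into an equivalent one. 2. Invariance under interchange of winning and losing: the transformation $\pi_i\to1/\pi_i$ for all $i$ (i.e. $\lambda\to-\lambda$) transforms the prior into an equivalent one; equivalently $f_\Gamma(\gamma|I)=f_\Gamma(-\gamma|I)$. 3. Normalizability: $f_\Gamma$ is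 a proper prior, i.e. can be normalized to $\int_{\mathbb R^{t-1}}f_\Gamma(\gamma|I)\,d^{t-1}\gamma=1$. 4. Invariance under elimination of teams (for a family of priors, one for each number of teams): for every $t>2$, the prior for $t-1$ teams is equivalent to the marginal distribution of the first $t-1$ strengths under the prior for $t$ teams. *)

theory Defs
  imports "HOL-Probability.Probability"
begin

text \<open>
  The teams are \<open>1, \<dots>, t\<close>. A vector of log-strengths is an extensional function on \<open>{1..t}\<close>,
  and a prior is a measure on this product space; it need not be finite, since improper
  priors are a priori allowed.
\<close>

definition lspace :: "nat \<Rightarrow> (nat \<Rightarrow> real) measure" where
  "lspace t = (\<Pi>\<^sub>M i\<in>{1..t}. borel)"

definition is_prior :: "nat \<Rightarrow> (nat \<Rightarrow> real) measure \<Rightarrow> bool" where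
  "is_prior t M \<longleftrightarrow> sets M = sets (lspace t)"

definition strength :: "(nat \<Rightarrow> real) \<Rightarrow> nat \<Rightarrow> real" where
  "strength l i = exp (l i)"

definition zeta :: "nat \<Rightarrow> (nat \<Rightarrow> real) \<Rightarrow> real" where
  "zeta i l = strength l i / (1 + strength l i)"

definition gamma :: "nat \<Rightarrow> (nat \<Rightarrow> real) \<Rightarrow> nat \<Rightarrow> real" where
  "gamma t l = (\<lambda>i\<in>{1..<t}. l i - l t)"

abbreviation gamma_lebesgue :: "nat \<Rightarrow> (nat \<Rightarrow> real) measure" where
  "gamma_lebesgue t \<equiv> (\<Pi>\<^sub>M i\<in>{1..<t}. lborel)"

definition gamma_density ::
    "nat \<Rightarrow> (nat \<Rightarrow> real) measure \<Rightarrow> ((nat \<Rightarrow> real) \<Rightarrow> ennreal) \<Rightarrow> bool" where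
  "gamma_density t M f \<longleftrightarrow> distributed M (gamma_lebesgue t) (gamma t) f"

text \<open>Equivalence includes the existence of both induced densities.\<close>

definition prior_equiv :: "nat \<Rightarrow> (nat \<Rightarrow> real) measure \<Rightarrow> (nat \<Rightarrow> real) measure \<Rightarrow> bool" where
  "prior_equiv t M N \<longleftrightarrow>
     is_prior t M \<and> is_prior t N \<and>
     (\<exists>f g. gamma_density t M f \<and> gamma_density t N g \<and> (AE x in gamma_lebesgue t. f x = g x))"

definition interchange_teams_invariant :: "nat \<Rightarrow> (nat \<Rightarrow> real) measure \<Rightarrow> bool" where
  "interchange_teams_invariant t M \<longleftrightarrow>
     (\<forall>i\<in>{1..t}. \<forall>j\<in>{1..t}. i \<noteq> j \<longrightarrow>
        prior_equiv t (distr M (lspace t) (\<lambda>l. l(i := l j, j := l i))) M)"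

definition win_loss_invariant :: "nat \<Rightarrow> (nat \<Rightarrow> real) measure \<Rightarrow> bool" where
  "win_loss_invariant t M \<longleftrightarrow>
     prior_equiv t (distr M (lspace t) (\<lambda>l. \<lambda>i\<in>{1..t}. - l i)) M"

definition normalizable :: "nat \<Rightarrow> (nat \<Rightarrow> real) measure \<Rightarrow> bool" where
  "normalizable t M \<longleftrightarrow>
     (\<exists>f. gamma_density t M f \<and>
        (\<exists>c::real. c > 0 \<and> (\<integral>\<^sup>+ x. ennreal c * f x \<partial>gamma_lebesgue t) = 1))"

definition elimination_invariant :: "(nat \<Rightarrow> (nat \<Rightarrow> real) measure) \<Rightarrow> bool" where
  "elimination_invariant P \<longleftrightarrow>
     (\<forall>t>2. prior_equiv (t - 1)
        (P (t - 1)) (distr (P t) (lspace (t - 1)) (\<lambda>l. restrict l {1..t - 1})))"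

definition iid_density_prop ::
    "'w measure \<Rightarrow> 'i set \<Rightarrow> ('i \<Rightarrow> 'w \<Rightarrow> real) \<Rightarrow> (real \<Rightarrow> real) \<Rightarrow> bool" where
  "iid_density_prop M I X g \<longleftrightarrow>
     prob_space M \<and> prob_space.indep_vars M (\<lambda>_. borel) X I \<and>
     (\<exists>c>0. \<forall>i\<in>I. distributed M lborel (X i) (\<lambda>x. ennreal (c * g x)))"

definition logistic3_kernel :: "real \<Rightarrow> real \<Rightarrow> real" where
  "logistic3_kernel \<eta> x = (1 + exp (- x)) powr (- \<eta>) * (1 + exp x) powr (- \<eta>)"

definition beta_kernel :: "real \<Rightarrow> real \<Rightarrow> real" where
  "beta_kernel \<eta> z = (if 0 < z \<and> z < 1 then z powr (\<eta> - 1) * (1 - z) powr (\<eta> - 1) else 0)"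

definition logistic3_prior :: "real \<Rightarrow> nat \<Rightarrow> (nat \<Rightarrow> real) measure \<Rightarrow> bool" where
  "logistic3_prior \<eta> t M \<longleftrightarrow>
     is_prior t M \<and> iid_density_prop M {1..t} (\<lambda>i l. l i) (logistic3_kernel \<eta>)"

definition beta_prior :: "real \<Rightarrow> nat \<Rightarrow> (nat \<Rightarrow> real) measure \<Rightarrow> bool" where
  "beta_prior \<eta> t M \<longleftrightarrow>
     is_prior t M \<and> iid_density_prop M {1..t} zeta (beta_kernel \<eta>)"

end

(*  With N the common law of the log-strengths, each transformation in desiderata 1, 2 and 4 maps the
    product N x ... x N exactly to such a product (N is symmetric for 2), so equivalence reduces to
    the existence of the density of gamma. That density exists by Radon-Nikodym: given l t = y, the
    coordinates of gamma are independent with the density of N shifted by y, so by Fubini gamma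
    hits every Lebesgue null set with probability 0. The Beta form is the substitution
    z = exp x / (1 + exp x), for which dz = z (1 - z) dx. *)

theory Submission
  imports Defs
begin

section \<open>Product measures with densities\<close>

text \<open>The indicator of a box is the product of the indicators of its sides, so the integral of
  the product density over a box factorises, and boxes determine a finite product measure.
  Sigma-finiteness of the factors with density is a separate hypothesis because a density with
  infinite values can destroy it.\<close>

lemma PiM_density:
  assumes fin: "finite I"
    and M: "product_sigma_finite M"
    and D: "product_sigma_finite (\<lambda>i. density (M i) (f i))"
    and f [measurable]: "\<And>i. i \<in> I \<Longrightarrow> f i \<in> borel_measurable (M i)"
  shows "(\<Pi>\<^sub>M i\<in>I. density (M i) (f i)) = density (PiM I M) (\<lambda>x. \<Prod>i\<in>I. f i (x i))"
proof -
  interpret M: product_sigma_finite M by fact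
  interpret D: product_sigma_finite "\<lambda>i. density (M i) (f i)" by fact
  show ?thesis
  proof (rule D.PiM_eqI [OF fin, symmetric])
    show "sets (density (PiM I M) (\<lambda>x. \<Prod>i\<in>I. f i (x i))) = sets (\<Pi>\<^sub>M i\<in>I. density (M i) (f i))"
      by (simp cong: sets_PiM_cong)
  next
    fix A assume "\<And>i. i \<in> I \<Longrightarrow> A i \<in> sets (density (M i) (f i))"
    then have A [measurable]: "A i \<in> sets (M i)" if "i \<in> I" for i using that by simp
    have "emeasure (density (PiM I M) (\<lambda>x. \<Prod>i\<in>I. f i (x i))) (Pi\<^sub>E I A)
        = (\<integral>\<^sup>+ x. (\<Prod>i\<in>I. f i (x i)) * indicator (Pi\<^sub>E I A) x \<partial>PiM I M)"
      using fin by (subst emeasure_density) (auto intro!: sets_PiM_I_finite)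
    also have "\<dots> = (\<integral>\<^sup>+ x. (\<Prod>i\<in>I. f i (x i) * indicator (A i) (x i)) \<partial>PiM I M)"
    proof (rule nn_integral_cong)
      fix x assume x: "x \<in> space (PiM I M)"
      have "indicator (Pi\<^sub>E I A) x = (\<Prod>i\<in>I. indicator (A i) (x i) :: ennreal)"
        using x fin by (auto simp: space_PiM PiE_iff indicator_def prod_zero_iff)
      then show "(\<Prod>i\<in>I. f i (x i)) * indicator (Pi\<^sub>E I A) x
          = (\<Prod>i\<in>I. f i (x i) * indicator (A i) (x i))"
        by (simp add: prod.distrib)
    qed
    also have "\<dots> = (\<Prod>i\<in>I. \<integral>\<^sup>+ y. f i y * indicator (A i) y \<partial>M i)"
      by (rule M.product_nn_integral_prod [OF fin]) measurable
    also have "\<dots> = (\<Prod>i\<in>I. emeasure (density (M i) (f i)) (A i))"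
      by (intro prod.cong refl) (simp add: emeasure_density)
    finally show "emeasure (density (PiM I M) (\<lambda>x. \<Prod>i\<in>I. f i (x i))) (Pi\<^sub>E I A)
        = (\<Prod>i\<in>I. emeasure (density (M i) (f i)) (A i))" .
  qed
qed

text \<open>The product measure has a density by \<open>PiM_density\<close>, hence charges no
  Lebesgue null set. Below this is applied to the shifted laws.\<close>

lemma absolutely_continuous_PiM_lborel:
  fixes h :: "real \<Rightarrow> ennreal"
  assumes fin: "finite J" and [measurable]: "h \<in> borel_measurable borel"
    and p: "prob_space (density lborel h)"
  shows "absolutely_continuous (\<Pi>\<^sub>M i\<in>J. lborel) (\<Pi>\<^sub>M i\<in>J. density lborel h)"
proof -
  interpret L: product_sigma_finite "\<lambda>_. lborel :: real measure"
    by standard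
  interpret P: prob_space "density lborel h" by (rule p)
  have "(\<Pi>\<^sub>M i\<in>J. density lborel h) = density (\<Pi>\<^sub>M i\<in>J. lborel) (\<lambda>x. \<Prod>i\<in>J. h (x i))"
    by (rule PiM_density [OF fin])
      (auto intro!: product_sigma_finite.intro lborel.sigma_finite_measure_axioms
        P.sigma_finite_measure_axioms)
  then show ?thesis
    by (simp add: absolutely_continuousI_density)
qed

text \<open>Translation invariance: writing \<open>lborel\<close> as its own image under translation
  by \<open>- y\<close> turns the shifted density into a pushforward.\<close>

lemma distr_density_lborel_minus:
  fixes h :: "real \<Rightarrow> ennreal"
  assumes [measurable]: "h \<in> borel_measurable borel"
  shows "distr (density lborel h) lborel (\<lambda>z. z - y) = density lborel (\<lambda>z. h (z + y))"
proof -
  have "density lborel (\<lambda>z. h (z + y)) = density (distr lborel borel ((+) (- y))) (\<lambda>z. h (z + y))"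
    by (simp only: lborel_distr_plus)
  also have "\<dots> = distr (density lborel h) borel (\<lambda>z. - y + z)"
    by (subst density_distr) auto
  also have "\<dots> = distr (density lborel h) lborel (\<lambda>z. z - y)"
    by (intro distr_cong) auto
  finally show ?thesis ..
qed

section \<open>Existence of the density of the strength differences\<close>

lemma gamma_measurable:
  assumes "sets M = sets (lspace t)" "t \<ge> 1"
  shows "gamma t \<in> measurable M (gamma_lebesgue t)"
proof -
  have [measurable]: "(\<lambda>l. l i) \<in> borel_measurable (lspace t)" if "i \<in> {1..t}" for i
    using that unfolding lspace_def by measurable
  have "gamma t \<in> measurable (lspace t) (gamma_lebesgue t)"
    unfolding gamma_def [abs_def]
  proof (rule measurable_restrict)
    fix i assume "i \<in> {1..<t}"
    then have "(\<lambda>l. l i - l t) \<in> borel_measurable (lspace t)"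
      using assms(2) by (intro borel_measurable_diff) auto
    then show "(\<lambda>l. l i - l t) \<in> measurable (lspace t) lborel" by simp
  qed
  then show ?thesis
    by (simp add: measurable_cong_sets [OF assms(1) refl])
qed

text \<open>Only a probability density \<open>h\<close> for a single team is assumed, so the shape
  of the kernel does not enter. An abstract density suffices, since equivalence and normalizability
  ask for no formula.\<close>

lemma gamma_density_exists:
  fixes h :: "real \<Rightarrow> ennreal"
  assumes h [measurable]: "h \<in> borel_measurable borel"
    and p: "prob_space (density lborel h)"
    and t: "t \<ge> 1"
  shows "\<exists>f. gamma_density t (\<Pi>\<^sub>M i\<in>{1..t}. density lborel h) f"
proof -
  let ?N = "density lborel h"
  let ?J = "{1..<t}"
  let ?P = "\<Pi>\<^sub>M i\<in>{1..t}. ?N"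
  let ?L = "gamma_lebesgue t"
  interpret N: prob_space ?N by (rule p)
  interpret P: product_sigma_finite "\<lambda>_. ?N"
    by standard
  interpret L: product_sigma_finite "\<lambda>_. lborel :: real measure"
    by standard
  interpret LJ: finite_product_sigma_finite "\<lambda>_. lborel :: real measure" ?J
    by standard auto
  \<comment> \<open>Team \<open>t\<close> is the reference in every difference; it is split off so
    that Fubini can make its log-strength the outer variable.\<close>
  have ins: "{1..t} = insert t ?J" using t by auto
  have setsP: "sets ?P = sets (lspace t)"
    unfolding lspace_def by (simp cong: sets_PiM_cong)
  have g [measurable]: "gamma t \<in> measurable ?P ?L"
    by (rule gamma_measurable [OF setsP t])
  have sets_J: "sets (\<Pi>\<^sub>M i\<in>?J. ?N) = sets ?L"
    by (simp cong: sets_PiM_cong)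
  have "absolutely_continuous ?L (distr ?P ?L (gamma t))"
    unfolding absolutely_continuous_def
  proof
    fix A assume A: "A \<in> null_sets ?L"
    then have [measurable]: "A \<in> sets ?L" by auto
    \<comment> \<open>Once the last coordinate is frozen at \<open>y\<close>, \<open>gamma t\<close>
      subtracts \<open>y\<close> from each coordinate in \<open>?J\<close>, so the image law is a
      product of shifted laws and gives \<open>A\<close> mass 0.\<close>
    have inner: "(\<integral>\<^sup>+ x. indicator A (gamma t (x(t := y))) \<partial>(\<Pi>\<^sub>M i\<in>?J. ?N)) = 0" for y
    proof -
      have pr: "prob_space (density lborel (\<lambda>z. h (z + y)))"
        unfolding distr_density_lborel_minus [OF h, symmetric]
        by (rule N.prob_space_distr) simp
      have m: "compose ?J (\<lambda>z. z - y) \<in> measurable (\<Pi>\<^sub>M i\<in>?J. ?N) ?L"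
        unfolding compose_def by (rule measurable_restrict) simp
      have "(\<integral>\<^sup>+ x. indicator A (gamma t (x(t := y))) \<partial>(\<Pi>\<^sub>M i\<in>?J. ?N))
          = (\<integral>\<^sup>+ x. indicator A (compose ?J (\<lambda>z. z - y) x) \<partial>(\<Pi>\<^sub>M i\<in>?J. ?N))"
        by (intro nn_integral_cong arg_cong [where f = "indicator A"])
          (auto simp: gamma_def compose_def)
      also have "\<dots> = emeasure (distr (\<Pi>\<^sub>M i\<in>?J. ?N) ?L (compose ?J (\<lambda>z. z - y))) A"
        using m by (subst nn_integral_distr [OF m, symmetric]) (auto simp del: One_nat_def)
      \<comment> \<open>The target factors change from \<open>lborel\<close> to \<open>?N\<close>,
        which has the same sets, so that the rule for coordinatewise images of products of
        probability spaces applies.\<close>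
      also have "distr (\<Pi>\<^sub>M i\<in>?J. ?N) ?L (compose ?J (\<lambda>z. z - y))
          = distr (\<Pi>\<^sub>M i\<in>?J. ?N) (\<Pi>\<^sub>M i\<in>?J. ?N) (compose ?J (\<lambda>z. z - y))"
        by (intro distr_cong) (simp_all add: sets_J del: One_nat_def)
      also have "\<dots> = (\<Pi>\<^sub>M i\<in>?J. distr ?N ?N (\<lambda>z. z - y))"
        by (rule distr_PiM_finite_prob_space') (auto intro: p)
      also have "distr ?N ?N (\<lambda>z. z - y) = density lborel (\<lambda>z. h (z + y))"
        unfolding distr_density_lborel_minus [OF h, symmetric] by (intro distr_cong) auto
      also have "emeasure (\<Pi>\<^sub>M i\<in>?J. density lborel (\<lambda>z. h (z + y))) A = 0"
        using absolutely_continuous_PiM_lborel [OF _ _ pr, of ?J] A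
        unfolding absolutely_continuous_def by auto
      finally show ?thesis .
    qed
    have "emeasure (distr ?P ?L (gamma t)) A = (\<integral>\<^sup>+ l. indicator A (gamma t l) \<partial>?P)"
      by (subst nn_integral_distr [OF g, symmetric]) (auto simp del: One_nat_def)
    also have "\<dots> = (\<integral>\<^sup>+ y. \<integral>\<^sup>+ x. indicator A (gamma t (x(t := y))) \<partial>(\<Pi>\<^sub>M i\<in>?J. ?N) \<partial>?N)"
      using g unfolding ins by (intro P.product_nn_integral_insert_rev) (auto simp del: One_nat_def)
    also have "\<dots> = 0" unfolding inner by simp
    finally show "A \<in> null_sets (distr ?P ?L (gamma t))"
      by (intro null_setsI) (simp_all del: One_nat_def)
  qed
  then obtain f where "f \<in> borel_measurable ?L" "density ?L f = distr ?P ?L (gamma t)"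
    using LJ.Radon_Nikodym [of "distr ?P ?L (gamma t)"] by auto
  then show ?thesis
    unfolding gamma_density_def distributed_def using g
    by (intro exI [of _ f] conjI) (simp_all del: One_nat_def)
qed

section \<open>Product priors\<close>

lemma sets_PiM_borel:
  assumes "sets N = sets borel"
  shows "sets (\<Pi>\<^sub>M i\<in>{1..t}. N) = sets (lspace t)"
  unfolding lspace_def using assms by (intro sets_PiM_cong) auto

text \<open>The vector of all coordinates is the identity on the space of extensional functions, so
  independence of the coordinates says that \<open>M\<close> is the product of its own marginals.
  The bound \<open>t \<ge> 1\<close> supplies a coordinate whose law shows that the density has
  total mass 1.\<close>

lemma iid_density_prop_imp_PiM:
  assumes pr: "is_prior t M" and t: "t \<ge> 1"
    and iid: "iid_density_prop M {1..t} (\<lambda>i l. l i) g"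
  obtains c :: real where "c > 0" "prob_space (density lborel (\<lambda>x. ennreal (c * g x)))"
    "M = (\<Pi>\<^sub>M i\<in>{1..t}. density lborel (\<lambda>x. ennreal (c * g x)))"
proof -
  from iid obtain c where c: "c > 0" and M: "prob_space M"
    and ind: "prob_space.indep_vars M (\<lambda>_. borel) (\<lambda>i l. l i) {1..t}"
    and d: "\<And>i. i \<in> {1..t} \<Longrightarrow> distributed M lborel (\<lambda>l. l i) (\<lambda>x. ennreal (c * g x))"
    unfolding iid_density_prop_def by auto
  let ?N = "density lborel (\<lambda>x. ennreal (c * g x))"
  interpret prob_space M by (rule M)
  have setsM: "sets M = sets (\<Pi>\<^sub>M i\<in>{1..t}. borel)"
    using pr by (simp add: is_prior_def lspace_def)
  have rv: "random_variable borel (\<lambda>l. l i)" if "i \<in> {1..t}" for i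
    using distributed_measurable [OF d [OF that]] by simp
  have dN: "distr M borel (\<lambda>l. l i) = ?N" if "i \<in> {1..t}" for i
    using distributed_distr_eq_density [OF d [OF that]] by (metis distr_cong sets_lborel)
  have "prob_space (distr M borel (\<lambda>l. l t))"
    using t by (intro prob_space_distr rv) auto
  then have N: "prob_space ?N" using dN [of t] t by simp
  have "M = distr M (\<Pi>\<^sub>M i\<in>{1..t}. borel) (\<lambda>l. l)"
    by (rule distr_id2 [symmetric]) (simp add: setsM)
  also have "\<dots> = distr M (\<Pi>\<^sub>M i\<in>{1..t}. borel) (\<lambda>l. \<lambda>i\<in>{1..t}. l i)"
    using sets_eq_imp_space_eq [OF setsM]
    by (intro distr_cong) (auto simp: space_PiM PiE_def extensional_restrict)
  also have "\<dots> = (\<Pi>\<^sub>M i\<in>{1..t}. distr M borel (\<lambda>l. l i))"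
    using ind t by (subst (asm) indep_vars_iff_distr_eq_PiM') (auto intro: rv)
  also have "\<dots> = (\<Pi>\<^sub>M i\<in>{1..t}. ?N)"
    by (intro PiM_cong) (auto simp: dN)
  finally show ?thesis by (intro that [OF c N])
qed

text \<open>Converse of the preceding lemma; it yields existence of the prior.\<close>

lemma iid_density_prop_PiM:
  fixes t :: nat
  assumes t: "t \<ge> 1" and c: "c > 0" and [measurable]: "g \<in> borel_measurable borel"
    and p: "prob_space (density lborel (\<lambda>x. ennreal (c * g x)))"
  shows "iid_density_prop (\<Pi>\<^sub>M i\<in>{1..t}. density lborel (\<lambda>x. ennreal (c * g x)))
    {1..t} (\<lambda>i l. l i) g"
proof -
  let ?N = "density lborel (\<lambda>x. ennreal (c * g x))"
  let ?M = "\<Pi>\<^sub>M i\<in>{1..t}. ?N"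
  interpret prob_space ?M by (intro prob_space_PiM p)
  have rv: "(\<lambda>l. l i) \<in> borel_measurable ?M" if "i \<in> {1..t}" for i
    using measurable_component_singleton [OF that, of "\<lambda>_. ?N"] by simp
  have comp: "distr ?M ?N (\<lambda>l. l i) = ?N" if "i \<in> {1..t}" for i
    using distr_PiM_component [of "{1..t}" "\<lambda>_. ?N" i] p that by auto
  have dN: "distr ?M borel (\<lambda>l. l i) = ?N" if "i \<in> {1..t}" for i
    using comp [OF that] by (metis distr_cong sets_density sets_lborel)
  have "distr ?M (\<Pi>\<^sub>M i\<in>{1..t}. borel) (\<lambda>l. \<lambda>i\<in>{1..t}. l i) = distr ?M ?M (\<lambda>l. l)"
    by (intro distr_cong)
      (auto simp: space_PiM PiE_def extensional_restrict cong: sets_PiM_cong)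
  also have "\<dots> = ?M" by simp
  also have "\<dots> = (\<Pi>\<^sub>M i\<in>{1..t}. distr ?M borel (\<lambda>l. l i))"
    by (intro PiM_cong) (simp_all add: dN del: One_nat_def)
  finally have ind: "indep_vars (\<lambda>_. borel) (\<lambda>i l. l i) {1..t}"
    using t rv by (intro indep_vars_iff_distr_eq_PiM' [THEN iffD2]) simp_all
  have "distributed ?M lborel (\<lambda>l. l i) (\<lambda>x. ennreal (c * g x))" if "i \<in> {1..t}" for i
  proof -
    have "distr ?M lborel (\<lambda>l. l i) = distr ?M borel (\<lambda>l. l i)" by (intro distr_cong) auto
    then show ?thesis unfolding distributed_def dN [OF that] using rv [OF that] by simp
  qed
  then show ?thesis
    unfolding iid_density_prop_def using c ind prob_space_axioms by auto
qed

section \<open>Images of product priors under the transformations of the desiderata\<close>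

lemma distr_PiM_transpose:
  assumes N: "prob_space N" and sN: "sets N = sets borel"
    and ij: "i \<in> {1..t}" "j \<in> {1..t}"
  shows "distr (\<Pi>\<^sub>M k\<in>{1..t}. N) (lspace t) (\<lambda>l. l(i := l j, j := l i)) = (\<Pi>\<^sub>M k\<in>{1..t}. N)"
proof -
  \<comment> \<open>Swapping two log-strengths amounts to relabelling the coordinates by this
    transposition, and relabelling preserves a product of identical factors.\<close>
  let ?f = "id(i := j, j := i)"
  have "distr (\<Pi>\<^sub>M k\<in>{1..t}. N) (lspace t) (\<lambda>l. l(i := l j, j := l i))
      = distr (\<Pi>\<^sub>M k\<in>{1..t}. N) (\<Pi>\<^sub>M k\<in>{1..t}. N) (\<lambda>l. \<lambda>k\<in>{1..t}. l (?f k))"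
    using ij by (intro distr_cong)
      (auto simp: sets_PiM_borel [OF sN] space_PiM PiE_def extensional_def fun_eq_iff
        simp del: One_nat_def)
  also have "\<dots> = (\<Pi>\<^sub>M k\<in>{1..t}. N)"
  proof (rule distr_PiM_reindex)
    show "inj_on ?f {1..t}" by (auto simp: inj_on_def)
    show "?f \<in> {1..t} \<rightarrow> {1..t}" using ij by auto
  qed (rule N)
  finally show ?thesis .
qed

lemma distr_PiM_uminus:
  fixes N :: "real measure"
  assumes N: "prob_space N" and sN: "sets N = sets borel"
    and sym: "distr N N uminus = N"
  shows "distr (\<Pi>\<^sub>M k\<in>{1..t}. N) (lspace t) (\<lambda>l. \<lambda>i\<in>{1..t}. - l i) = (\<Pi>\<^sub>M k\<in>{1..t}. N)"
proof -
  have m: "uminus \<in> measurable N N"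
    using measurable_cong_sets [OF sN sN] by simp
  have "distr (\<Pi>\<^sub>M k\<in>{1..t}. N) (lspace t) (\<lambda>l. \<lambda>i\<in>{1..t}. - l i)
      = distr (\<Pi>\<^sub>M k\<in>{1..t}. N) (\<Pi>\<^sub>M k\<in>{1..t}. N) (compose {1..t} uminus)"
    by (intro distr_cong) (auto simp: sets_PiM_borel [OF sN] compose_def simp del: One_nat_def)
  also have "\<dots> = (\<Pi>\<^sub>M k\<in>{1..t}. distr N N uminus)"
    by (rule distr_PiM_finite_prob_space') (auto intro: N m)
  finally show ?thesis by (simp add: sym)
qed

lemma distr_PiM_eliminate:
  assumes N: "prob_space N" and sN: "sets N = sets borel"
  shows "distr (\<Pi>\<^sub>M k\<in>{1..t}. N) (lspace (t - 1)) (\<lambda>l. restrict l {1..t - 1})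
    = (\<Pi>\<^sub>M k\<in>{1..t - 1}. N)"
proof -
  interpret product_prob_space "\<lambda>_. N" by (rule product_prob_spaceI) (rule N)
  have "(\<Pi>\<^sub>M k\<in>{1..t - 1}. N)
      = distr (\<Pi>\<^sub>M k\<in>{1..t}. N) (\<Pi>\<^sub>M k\<in>{1..t - 1}. N) (\<lambda>l. restrict l {1..t - 1})"
    by (rule distr_restrict) auto
  also have "\<dots> = distr (\<Pi>\<^sub>M k\<in>{1..t}. N) (lspace (t - 1)) (\<lambda>l. restrict l {1..t - 1})"
    by (intro distr_cong) (auto simp: sets_PiM_borel [OF sN] simp del: One_nat_def)
  finally show ?thesis ..
qed

lemma prior_equiv_refl:
  assumes "is_prior t M" "gamma_density t M f"
  shows "prior_equiv t M M"
  using assms unfolding prior_equiv_def by auto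

text \<open>The image of a probability measure under \<open>gamma t\<close> has mass 1, so its
  density is already normalized and \<open>c = 1\<close> works.\<close>

lemma gamma_density_normalizable:
  assumes "prob_space M" "gamma_density t M f"
  shows "normalizable t M"
proof -
  have d: "distr M (gamma_lebesgue t) (gamma t) = density (gamma_lebesgue t) f"
    and f: "f \<in> borel_measurable (gamma_lebesgue t)"
    and g: "gamma t \<in> measurable M (gamma_lebesgue t)"
    using assms(2) unfolding gamma_density_def distributed_def by auto
  have "prob_space (density (gamma_lebesgue t) f)"
    unfolding d [symmetric] by (rule prob_space.prob_space_distr [OF assms(1) g])
  then have "(\<integral>\<^sup>+ x. f x \<partial>gamma_lebesgue t) = 1"
    using prob_space.emeasure_space_1 [of "density (gamma_lebesgue t) f"] f
    by (simp add: emeasure_density cong: nn_integral_cong_simp del: One_nat_def)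
  then show ?thesis
    unfolding normalizable_def using assms(2) by (intro exI [of _ f] conjI exI [of _ 1]) auto
qed

section \<open>The logistic and Beta kernels\<close>

lemma logistic3_kernel_measurable [measurable]: "logistic3_kernel \<eta> \<in> borel_measurable borel"
  unfolding logistic3_kernel_def [abs_def] by measurable

lemma beta_kernel_measurable [measurable]: "beta_kernel \<eta> \<in> borel_measurable borel"
  unfolding beta_kernel_def [abs_def] by measurable

lemma logistic3_kernel_pos: "logistic3_kernel \<eta> x > 0"
proof -
  have "1 + exp x > 0" "1 + exp (- x) > 0" by (simp_all add: add_pos_pos)
  then show ?thesis unfolding logistic3_kernel_def by simp
qed

lemma logistic3_kernel_uminus: "logistic3_kernel \<eta> (- x) = logistic3_kernel \<eta> x"
  unfolding logistic3_kernel_def by simp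

text \<open>One factor is at most 1 and the other at most a pure exponential; evenness of the kernel
  then gives the absolute value. This tail bound makes the kernel integrable.\<close>

lemma logistic3_kernel_le:
  assumes "\<eta> > 0"
  shows "logistic3_kernel \<eta> x \<le> exp (- (\<eta> * \<bar>x\<bar>))"
proof -
  have *: "logistic3_kernel \<eta> y \<le> exp (- (\<eta> * y))" for y
  proof -
    have "(1 + exp (- y)) powr (- \<eta>) \<le> 1 powr (- \<eta>)"
      using assms by (intro powr_mono2') auto
    moreover have "(1 + exp y) powr (- \<eta>) \<le> exp y powr (- \<eta>)"
      using assms by (intro powr_mono2') auto
    ultimately have "logistic3_kernel \<eta> y \<le> 1 * exp y powr (- \<eta>)"
      unfolding logistic3_kernel_def by (intro mult_mono) auto
    also have "exp y powr (- \<eta>) = exp (- (\<eta> * y))" by (simp add: powr_def)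
    finally show ?thesis by simp
  qed
  show ?thesis
    using * [of x] * [of "- x"] by (cases "x \<ge> 0") (auto simp: logistic3_kernel_uminus)
qed

lemma nn_integral_logistic3_kernel:
  assumes "\<eta> > 0"
  obtains Z where "Z > 0" "(\<integral>\<^sup>+ x. ennreal (logistic3_kernel \<eta> x) \<partial>lborel) = ennreal Z"
proof -
  let ?e = "exponential_density \<eta>"
  let ?I = "\<integral>\<^sup>+ x. ennreal (logistic3_kernel \<eta> x) \<partial>lborel"
  have e1: "(\<integral>\<^sup>+ x. ennreal (?e x) \<partial>lborel) = 1"
    using prob_space.emeasure_space_1 [OF prob_space_exponential_density [OF assms]]
    by (simp add: emeasure_density)
  have e2: "(\<integral>\<^sup>+ x. ennreal (?e (- x)) \<partial>lborel) = 1"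
    using nn_integral_real_affine [of "\<lambda>x. ennreal (?e x)" "-1" 0] e1 by simp
  \<comment> \<open>The exponential density and its reflection together dominate
    \<open>\<eta>\<close> times the tail bound, and each has integral 1.\<close>
  have "?I \<le> (\<integral>\<^sup>+ x. ennreal (1 / \<eta>) * (ennreal (?e x) + ennreal (?e (- x))) \<partial>lborel)"
  proof (rule nn_integral_mono)
    fix x :: real
    have "logistic3_kernel \<eta> x \<le> 1 / \<eta> * (?e x + ?e (- x))"
      using logistic3_kernel_le [OF assms, of x] assms
      by (auto simp: exponential_density_def field_simps abs_if)
    then show "ennreal (logistic3_kernel \<eta> x)
        \<le> ennreal (1 / \<eta>) * (ennreal (?e x) + ennreal (?e (- x)))"
      using assms exponential_density_nonneg [OF assms]
      by (simp add: ennreal_plus [symmetric] ennreal_mult'' [symmetric] ennreal_leI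
          del: ennreal_plus)
  qed
  also have "\<dots> = ennreal (1 / \<eta>) * (1 + 1)"
    using e1 e2 by (simp add: nn_integral_cmult nn_integral_add)
  also have "\<dots> < \<infinity>" by (simp add: ennreal_mult_less_top)
  finally have fin: "?I < \<infinity>" .
  have "?I \<noteq> 0"
  proof
    assume "?I = 0"
    then have "AE x in lborel. ennreal (logistic3_kernel \<eta> x) = 0"
      by (subst (asm) nn_integral_0_iff_AE) auto
    moreover have "ennreal (logistic3_kernel \<eta> x) \<noteq> 0" for x
      using logistic3_kernel_pos [of \<eta> x] by simp
    ultimately have "AE x in (lborel :: real measure). False" by simp
    then have "ae_filter (lborel :: real measure) = bot" by (simp add: trivial_limit_def)
    then show False by (simp add: ae_filter_eq_bot_iff)
  qed
  then show ?thesis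
    using fin that [of "enn2real ?I"] by (simp add: enn2real_positive_iff less_top zero_less_iff_neq_zero)
qed

text \<open>Forces the value of the constant that \<open>iid_density_prop\<close> leaves
  existentially quantified; uniqueness of the prior rests on this.\<close>

lemma prob_space_density_mult_iff:
  assumes "(\<integral>\<^sup>+ x. ennreal (g x) \<partial>lborel) = ennreal Z" "Z > 0" "c > 0"
    "g \<in> borel_measurable borel"
  shows "prob_space (density lborel (\<lambda>x. ennreal (c * g x))) \<longleftrightarrow> c = 1 / Z"
proof -
  have "emeasure (density lborel (\<lambda>x. ennreal (c * g x))) UNIV = ennreal (c * Z)"
    using assms by (simp add: emeasure_density ennreal_mult' nn_integral_cmult)
  then have "prob_space (density lborel (\<lambda>x. ennreal (c * g x))) \<longleftrightarrow> ennreal (c * Z) = 1"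
    using prob_space.emeasure_space_1 by (fastforce intro: prob_spaceI)
  then show ?thesis using assms by (simp add: field_simps)
qed

text \<open>The constant \<open>c\<close> is obtained before \<open>t\<close>, so all numbers of
  teams share one single-team law, as elimination of teams requires.\<close>

lemma logistic3_prior_iff_PiM:
  assumes "\<eta> > 0"
  obtains c where "c > 0" "prob_space (density lborel (\<lambda>x. ennreal (c * logistic3_kernel \<eta> x)))"
    "\<And>t M. t \<ge> 1 \<Longrightarrow> logistic3_prior \<eta> t M
      \<longleftrightarrow> M = (\<Pi>\<^sub>M i\<in>{1..t}. density lborel (\<lambda>x. ennreal (c * logistic3_kernel \<eta> x)))"
proof -
  obtain Z where Z: "Z > 0" "(\<integral>\<^sup>+ x. ennreal (logistic3_kernel \<eta> x) \<partial>lborel) = ennreal Z"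
    using nn_integral_logistic3_kernel [OF assms] .
  note iff = prob_space_density_mult_iff [OF Z(2,1) _ logistic3_kernel_measurable]
  have c: "1 / Z > 0" using Z by simp
  have p: "prob_space (density lborel (\<lambda>x. ennreal (1 / Z * logistic3_kernel \<eta> x)))"
    using iff [OF c] by simp
  show ?thesis
  proof (rule that [OF c p])
    fix t :: nat and M :: "(nat \<Rightarrow> real) measure" assume t: "t \<ge> 1"
    show "logistic3_prior \<eta> t M
      \<longleftrightarrow> M = (\<Pi>\<^sub>M i\<in>{1..t}. density lborel (\<lambda>x. ennreal (1 / Z * logistic3_kernel \<eta> x)))"
    proof
      assume "logistic3_prior \<eta> t M"
      then show "M = (\<Pi>\<^sub>M i\<in>{1..t}. density lborel (\<lambda>x. ennreal (1 / Z * logistic3_kernel \<eta> x)))"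
        unfolding logistic3_prior_def using iid_density_prop_imp_PiM [OF _ t] iff by metis
    next
      assume "M = (\<Pi>\<^sub>M i\<in>{1..t}. density lborel (\<lambda>x. ennreal (1 / Z * logistic3_kernel \<eta> x)))"
      then show "logistic3_prior \<eta> t M"
        unfolding logistic3_prior_def is_prior_def
        using iid_density_prop_PiM [OF t c logistic3_kernel_measurable p] sets_PiM_borel by simp
    qed
  qed
qed

text \<open>Both Lebesgue measure and the kernel are invariant under reflection.\<close>

lemma distr_logistic3_uminus:
  "distr (density lborel (\<lambda>x. ennreal (c * logistic3_kernel \<eta> x)))
     (density lborel (\<lambda>x. ennreal (c * logistic3_kernel \<eta> x))) uminus
   = density lborel (\<lambda>x. ennreal (c * logistic3_kernel \<eta> x))" (is "distr ?N ?N _ = _")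
proof -
  have "?N = density (distr lborel borel uminus) (\<lambda>x. ennreal (c * logistic3_kernel \<eta> x))"
    by (simp only: lborel_distr_uminus)
  also have "\<dots> = distr ?N borel uminus"
    by (subst density_distr) (auto simp: logistic3_kernel_uminus)
  also have "\<dots> = distr ?N ?N uminus"
    by (intro distr_cong) auto
  finally show ?thesis ..
qed

section \<open>Change of variables\<close>

definition sigmoid :: "real \<Rightarrow> real" where
  "sigmoid x = exp x / (1 + exp x)"

text \<open>The inverse of \<open>sigmoid\<close> on the open unit interval, the only place where
  its values matter.\<close>

definition logit :: "real \<Rightarrow> real" where
  "logit z = ln (z / (1 - z))"

lemma sigmoid_measurable [measurable]: "sigmoid \<in> borel_measurable borel"
  unfolding sigmoid_def [abs_def] by measurable

lemma logit_measurable [measurable]: "logit \<in> borel_measurable borel"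
  unfolding logit_def [abs_def] by measurable

lemma one_plus_exp_pos: "1 + exp (x :: real) > 0"
  by (simp add: add_pos_pos)

lemma sigmoid_bounds: "0 < sigmoid x" "sigmoid x < 1"
  using one_plus_exp_pos [of x] by (auto simp: sigmoid_def)

lemma one_minus_sigmoid: "1 - sigmoid x = 1 / (1 + exp x)"
  using one_plus_exp_pos [of x] by (simp add: sigmoid_def field_simps)

lemma logit_sigmoid: "logit (sigmoid x) = x"
  unfolding logit_def one_minus_sigmoid
  using one_plus_exp_pos [of x] by (simp add: sigmoid_def)

lemma sigmoid_logit:
  assumes "0 < z" "z < 1"
  shows "sigmoid (logit z) = z"
proof -
  have "exp (logit z) = z / (1 - z)" unfolding logit_def using assms by simp
  then show ?thesis
    unfolding sigmoid_def using one_plus_exp_pos [of "logit z"] assms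
    by (simp add: divide_simps) (simp add: algebra_simps)
qed

lemma sigmoid_le_iff: "sigmoid x \<le> sigmoid y \<longleftrightarrow> x \<le> y"
  using one_plus_exp_pos [of x] one_plus_exp_pos [of y]
  by (simp add: sigmoid_def field_simps)

lemma sigmoid_deriv: "(sigmoid has_real_derivative sigmoid x * (1 - sigmoid x)) (at x)"
  unfolding one_minus_sigmoid unfolding sigmoid_def [abs_def]
  using one_plus_exp_pos [of x]
  by (auto intro!: derivative_eq_intros simp: field_simps power2_eq_square)

text \<open>The two factors of the kernel are the \<open>\<eta>\<close>-th powers of
  \<open>1 - z\<close> and \<open>z\<close> at \<open>z = sigmoid x\<close>. Splitting one power off
  each leaves the Beta kernel times the derivative of \<open>sigmoid\<close>.\<close>

lemma logistic3_kernel_eq_beta_kernel: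
  "logistic3_kernel \<eta> x = beta_kernel \<eta> (sigmoid x) * (sigmoid x * (1 - sigmoid x))"
proof -
  have s: "sigmoid x = 1 / (1 + exp (- x))"
    using one_plus_exp_pos [of x] one_plus_exp_pos [of "- x"]
    by (simp add: sigmoid_def field_simps flip: exp_add)
  have a: "(1 + exp (- x)) powr (- \<eta>) = sigmoid x powr \<eta>"
    unfolding s using one_plus_exp_pos [of "- x"] by (simp add: powr_minus powr_divide inverse_eq_divide)
  have b: "(1 + exp x) powr (- \<eta>) = (1 - sigmoid x) powr \<eta>"
    unfolding one_minus_sigmoid using one_plus_exp_pos [of x]
    by (simp add: powr_minus powr_divide inverse_eq_divide)
  have p: "y powr \<eta> = y powr (\<eta> - 1) * y" if "y > 0" for y :: real
    using that by (simp add: powr_diff)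
  show ?thesis
    unfolding logistic3_kernel_def a b beta_kernel_def
    using sigmoid_bounds [of x] p [of "sigmoid x"] p [of "1 - sigmoid x"] by simp
qed

text \<open>The library's substitution rule covers compact intervals only, so the identity is obtained on
  \<open>{- n..n}\<close>, whose images under \<open>sigmoid\<close> exhaust \<open>{0<..<1}\<close>.\<close>

lemma nn_integral_sigmoid:
  fixes f :: "real \<Rightarrow> real"
  assumes [measurable]: "f \<in> borel_measurable borel"
    and f0: "\<And>z. f z \<ge> 0" and f1: "\<And>z. \<not> (0 < z \<and> z < 1) \<Longrightarrow> f z = 0"
  shows "(\<integral>\<^sup>+ z. ennreal (f z) \<partial>lborel)
    = (\<integral>\<^sup>+ x. ennreal (f (sigmoid x) * (sigmoid x * (1 - sigmoid x))) \<partial>lborel)"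
proof -
  define A where "A n = {- real n..real n}" for n
  define B where "B n = {sigmoid (- real n)..sigmoid (real n)}" for n
  let ?g = "\<lambda>x. f (sigmoid x) * (sigmoid x * (1 - sigmoid x))"
  have [measurable]: "A n \<in> sets borel" "B n \<in> sets borel" for n
    by (simp_all add: A_def B_def)
  have incA: "incseq A" and incB: "incseq B"
    by (auto simp: incseq_def A_def B_def intro: order_trans simp: sigmoid_le_iff)
  have A_ex: "\<exists>n. x \<in> A n" for x
    using real_arch_simple [of "\<bar>x\<bar>"] by (auto simp: A_def abs_le_iff minus_le_iff)
  have B_ex: "\<exists>n. z \<in> B n" if "0 < z" "z < 1" for z
  proof -
    obtain n where "logit z \<in> A n" using A_ex by blast
    then have "sigmoid (logit z) \<in> B n" by (auto simp: A_def B_def sigmoid_le_iff)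
    then show ?thesis using sigmoid_logit [OF that] by auto
  qed
  \<comment> \<open>Truncations to increasing sets reach the full value once \<open>x\<close> is
    covered. The alternative \<open>h x = 0\<close> handles points outside the unit interval, which
    no \<open>B n\<close> covers.\<close>
  have SUP_ind: "(SUP n. ennreal (h x) * indicator (C n) x) = ennreal (h x)"
    if "h x = 0 \<or> (\<exists>n. x \<in> C n)" for h :: "real \<Rightarrow> real" and C :: "nat \<Rightarrow> real set" and x
  proof (rule antisym)
    show "(SUP n. ennreal (h x) * indicator (C n) x) \<le> ennreal (h x)"
      by (rule SUP_least) (auto split: split_indicator)
    show "ennreal (h x) \<le> (SUP n. ennreal (h x) * indicator (C n) x)"
    proof (cases "h x = 0")
      case False
      with that obtain n where "x \<in> C n" by auto
      then show ?thesis by (intro SUP_upper2 [of n]) auto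
    qed simp
  qed
  have inc: "incseq (\<lambda>n x. ennreal (h x) * indicator (C n) x)"
    if "incseq C" for h :: "real \<Rightarrow> real" and C
    using that by (auto simp: incseq_def le_fun_def split: split_indicator)
  have "(\<integral>\<^sup>+ z. ennreal (f z) \<partial>lborel) = (\<integral>\<^sup>+ z. (SUP n. ennreal (f z) * indicator (B n) z) \<partial>lborel)"
    using SUP_ind [of f _ B] f1 B_ex by (intro nn_integral_cong) (metis (no_types))
  also have "\<dots> = (SUP n. \<integral>\<^sup>+ z. ennreal (f z) * indicator (B n) z \<partial>lborel)"
    by (rule nn_integral_monotone_convergence_SUP) (auto intro: inc incB)
  also have "\<dots> = (SUP n. \<integral>\<^sup>+ x. ennreal (?g x) * indicator (A n) x \<partial>lborel)"
  proof (rule SUP_cong [OF refl])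
    fix n
    have "(\<integral>\<^sup>+ z. ennreal (f z * indicator (B n) z) \<partial>lborel)
        = (\<integral>\<^sup>+ x. ennreal (?g x * indicator (A n) x) \<partial>lborel)"
      \<comment> \<open>The products are regrouped so that the derivative
        \<open>sigmoid x * (1 - sigmoid x)\<close> stands as one factor, as the substitution rule
        expects.\<close>
      unfolding A_def B_def mult.assoc [symmetric]
      unfolding mult.assoc [of _ "sigmoid x" "1 - sigmoid x" for x]
    proof (rule nn_integral_substitution)
      show "continuous_on {- real n..real n} (\<lambda>x. sigmoid x * (1 - sigmoid x))"
        by (intro continuous_intros DERIV_continuous_on [OF has_field_derivative_at_within [OF sigmoid_deriv]])
      show "sigmoid x * (1 - sigmoid x) \<ge> 0" for x using sigmoid_bounds [of x] by simp
    qed (auto simp: set_borel_measurable_def sigmoid_deriv)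
    moreover have "ennreal (u * indicator C v) = ennreal u * indicator C v"
      for u v :: real and C by (auto split: split_indicator)
    ultimately show "(\<integral>\<^sup>+ z. ennreal (f z) * indicator (B n) z \<partial>lborel)
        = (\<integral>\<^sup>+ x. ennreal (?g x) * indicator (A n) x \<partial>lborel)" by simp
  qed
  also have "\<dots> = (\<integral>\<^sup>+ x. (SUP n. ennreal (?g x) * indicator (A n) x) \<partial>lborel)"
    by (rule nn_integral_monotone_convergence_SUP [symmetric]) (auto intro: inc incA)
  also have "\<dots> = (\<integral>\<^sup>+ x. ennreal (?g x) \<partial>lborel)"
    using SUP_ind [of ?g _ A] A_ex by (intro nn_integral_cong) auto
  finally show ?thesis .
qed

text \<open>Absorbing the indicator of \<open>S\<close> into the integrand reduces equality of
  measures to \<open>nn_integral_sigmoid\<close>. The Jacobian is part of the kernel identity, so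
  the same \<open>c\<close> serves both densities.\<close>

lemma distr_logistic3_sigmoid:
  assumes "c > 0"
  shows "distr (density lborel (\<lambda>x. ennreal (c * logistic3_kernel \<eta> x))) lborel sigmoid
    = density lborel (\<lambda>z. ennreal (c * beta_kernel \<eta> z))" (is "distr ?N _ _ = ?D")
proof (rule measure_eqI)
  fix S assume "S \<in> sets (distr ?N lborel sigmoid)"
  then have [measurable]: "S \<in> sets borel" by simp
  let ?f = "\<lambda>z. c * beta_kernel \<eta> z * indicator S z"
  have "emeasure (distr ?N lborel sigmoid) S
      = (\<integral>\<^sup>+ x. ennreal (c * logistic3_kernel \<eta> x) * indicator (sigmoid -` S) x \<partial>lborel)"
    using measurable_sets [OF sigmoid_measurable, of S]
    by (simp add: emeasure_distr emeasure_density)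
  also have "\<dots> = (\<integral>\<^sup>+ x. ennreal (?f (sigmoid x) * (sigmoid x * (1 - sigmoid x))) \<partial>lborel)"
    by (intro nn_integral_cong)
      (auto simp: logistic3_kernel_eq_beta_kernel mult_ac split: split_indicator)
  also have "\<dots> = (\<integral>\<^sup>+ z. ennreal (?f z) \<partial>lborel)"
    using assms by (intro nn_integral_sigmoid [symmetric]) (auto simp: beta_kernel_def)
  also have "\<dots> = (\<integral>\<^sup>+ z. ennreal (c * beta_kernel \<eta> z) * indicator S z \<partial>lborel)"
    by (intro nn_integral_cong) (auto split: split_indicator)
  also have "\<dots> = emeasure ?D S"
    by (simp add: emeasure_density)
  finally show "emeasure (distr ?N lborel sigmoid) S = emeasure ?D S" .
qed simp

section \<open>Equivalence of the logistic and Beta descriptions\<close>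

lemma distributed_logistic3_iff_beta:
  assumes c: "c > 0" and X [measurable]: "X \<in> borel_measurable M"
  shows "distributed M lborel X (\<lambda>x. ennreal (c * logistic3_kernel \<eta> x))
    \<longleftrightarrow> distributed M lborel (\<lambda>w. sigmoid (X w)) (\<lambda>z. ennreal (c * beta_kernel \<eta> z))"
proof -
  let ?N = "density lborel (\<lambda>x. ennreal (c * logistic3_kernel \<eta> x))"
  let ?D = "density lborel (\<lambda>z. ennreal (c * beta_kernel \<eta> z))"
  \<comment> \<open>Because \<open>logit\<close> undoes \<open>sigmoid\<close> on its range, pushing
    forward by \<open>sigmoid\<close> loses no information, and the law of \<open>X\<close> can be
    recovered from that of its image.\<close>
  have inv: "distr ?D lborel logit = ?N"
    unfolding distr_logistic3_sigmoid [OF c, symmetric]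
    by (subst distr_distr) (auto simp: comp_def logit_sigmoid intro!: distr_id2)
  have push: "distr M lborel (\<lambda>w. sigmoid (X w)) = distr (distr M lborel X) lborel sigmoid"
    by (subst distr_distr) (auto simp: comp_def)
  have pull: "distr M lborel X = distr (distr M lborel (\<lambda>w. sigmoid (X w))) lborel logit"
    by (subst distr_distr) (auto simp: comp_def logit_sigmoid)
  have "distr M lborel X = ?N \<longleftrightarrow> distr M lborel (\<lambda>w. sigmoid (X w)) = ?D"
    using inv push pull distr_logistic3_sigmoid [OF c, of \<eta>] by metis
  then show ?thesis unfolding distributed_def by auto
qed

lemma zeta_eq_sigmoid: "zeta i l = sigmoid (l i)"
  by (simp add: zeta_def strength_def sigmoid_def)

lemma logistic3_prior_iff_beta_prior: "logistic3_prior \<eta> t M \<longleftrightarrow> beta_prior \<eta> t M"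
\<comment> \<open>Both descriptions include this condition, so they fail together without it. With
  it, independence transfers by composing each coordinate with \<open>sigmoid\<close> or
  \<open>logit\<close>.\<close>
proof (cases "is_prior t M \<and> prob_space M")
  case True
  then interpret prob_space M by blast
  have rv: "(\<lambda>l. l i) \<in> borel_measurable M" if "i \<in> {1..t}" for i
    using True that measurable_component_singleton [OF that, of "\<lambda>_. borel :: real measure"]
    unfolding is_prior_def lspace_def by (metis measurable_cong_sets)
  have ind: "indep_vars (\<lambda>_. borel) (\<lambda>i l. l i) {1..t}
      \<longleftrightarrow> indep_vars (\<lambda>_. borel) (\<lambda>i l. sigmoid (l i)) {1..t}"
  proof
    assume "indep_vars (\<lambda>_. borel) (\<lambda>i l. l i) {1..t}"
    then show "indep_vars (\<lambda>_. borel) (\<lambda>i l. sigmoid (l i)) {1..t}"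
      by (rule indep_vars_compose2) simp
  next
    assume "indep_vars (\<lambda>_. borel) (\<lambda>i l. sigmoid (l i)) {1..t}"
    then have "indep_vars (\<lambda>_. borel) (\<lambda>i l. logit (sigmoid (l i))) {1..t}"
      by (rule indep_vars_compose2) simp
    then show "indep_vars (\<lambda>_. borel) (\<lambda>i l. l i) {1..t}"
      by (simp add: logit_sigmoid)
  qed
  show ?thesis
    unfolding logistic3_prior_def beta_prior_def iid_density_prop_def zeta_eq_sigmoid [abs_def] ind
    using distributed_logistic3_iff_beta [OF _ rv] by blast
next
  case False
  then show ?thesis
    unfolding logistic3_prior_def beta_prior_def iid_density_prop_def by auto
qed

text \<open>Unique existence for each \<open>t\<close> shows that the hypothesis on the family
  \<open>P\<close> can be satisfied. Values of \<open>P\<close> below 2 are unconstrained and never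
  consulted.\<close>

theorem mainTheorem8:
  fixes \<eta> :: real
  assumes "\<eta> > 0"
  shows "(\<forall>t\<ge>2. \<exists>!M. logistic3_prior \<eta> t M) \<and>
    (\<forall>t\<ge>2. \<forall>M. logistic3_prior \<eta> t M \<longleftrightarrow> beta_prior \<eta> t M) \<and>
    (\<forall>P. (\<forall>t\<ge>2. logistic3_prior \<eta> t (P t)) \<longrightarrow>
      (\<forall>t\<ge>2. interchange_teams_invariant t (P t)) \<and>
      (\<forall>t\<ge>2. win_loss_invariant t (P t)) \<and>
      (\<forall>t\<ge>2. normalizable t (P t)) \<and>
      elimination_invariant P)"
proof -
  obtain c where c: "c > 0"
    and p: "prob_space (density lborel (\<lambda>x. ennreal (c * logistic3_kernel \<eta> x)))"
    and iff: "\<And>t M. t \<ge> 1 \<Longrightarrow> logistic3_prior \<eta> t M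
      \<longleftrightarrow> M = (\<Pi>\<^sub>M i\<in>{1..t}. density lborel (\<lambda>x. ennreal (c * logistic3_kernel \<eta> x)))"
    using logistic3_prior_iff_PiM [OF assms] by metis
  define N where "N = density lborel (\<lambda>x. ennreal (c * logistic3_kernel \<eta> x))"
  have N: "prob_space N" and sN: "sets N = sets borel" and symN: "distr N N uminus = N"
    using p distr_logistic3_uminus by (auto simp: N_def)
  have dens: "\<exists>f. gamma_density t (\<Pi>\<^sub>M i\<in>{1..t}. N) f" if "t \<ge> 2" for t
    unfolding N_def using that p by (intro gamma_density_exists) auto
  have equiv: "prior_equiv t (\<Pi>\<^sub>M i\<in>{1..t}. N) (\<Pi>\<^sub>M i\<in>{1..t}. N)" if "t \<ge> 2" for t
    using dens [OF that] prior_equiv_refl sets_PiM_borel [OF sN] unfolding is_prior_def by blast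
  have "interchange_teams_invariant t (\<Pi>\<^sub>M i\<in>{1..t}. N)"
    and "win_loss_invariant t (\<Pi>\<^sub>M i\<in>{1..t}. N)"
    and "normalizable t (\<Pi>\<^sub>M i\<in>{1..t}. N)" if "t \<ge> 2" for t
    using equiv [OF that] dens [OF that] gamma_density_normalizable [OF prob_space_PiM [OF N]]
    unfolding interchange_teams_invariant_def win_loss_invariant_def
    by (auto simp: distr_PiM_transpose [OF N sN] distr_PiM_uminus [OF N sN symN] simp del: One_nat_def)
  moreover have "elimination_invariant P" if "\<And>t. t \<ge> 2 \<Longrightarrow> P t = (\<Pi>\<^sub>M i\<in>{1..t}. N)" for P
    unfolding elimination_invariant_def
  proof (intro allI impI)
    fix t :: nat assume "t > 2"
    \<comment> \<open>From \<open>t > 2\<close> follows \<open>t - 1 \<ge> 2\<close>, so both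
      members of the family are products of the same \<open>N\<close>.\<close>
    then show "prior_equiv (t - 1) (P (t - 1)) (distr (P t) (lspace (t - 1)) (\<lambda>l. restrict l {1..t - 1}))"
      using equiv [of "t - 1"] that [of t] that [of "t - 1"]
      by (simp add: distr_PiM_eliminate [OF N sN, simplified])
  qed
  moreover have "logistic3_prior \<eta> t M \<longleftrightarrow> M = (\<Pi>\<^sub>M i\<in>{1..t}. N)" if "t \<ge> 2" for t M
    using iff [of t M] that by (simp add: N_def)
  ultimately show ?thesis
    using logistic3_prior_iff_beta_prior by auto
qed

end
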